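(* Let $\mathbf{C}$ be a dagger 2-category that admits the construction of FEM-algebras. Then dagger Frobenius monads in $\mathbf{C}$ factor as dagger adjunctions: for every dagger Frobenius monad $(C,T,\eta,\mu)$ in $\mathbf{C}$ there are an object $D$ of $\mathbf{C}$ and an adjunction in $\mathbf{C}$, with left adjoint $J\colon C\to D$ and right adjoint $E\colon D\to C$, whose induced monad on $C$ is $(T,\eta,\mu)$.
   Context: A dagger on a category $\mathbf{D}$ is a functor $\dagger\colon\mathbf{D}^{\mathrm{op}}\to\mathbf{D}$ with $A^\dagger=A$ on objects and $f^{\dagger\dagger}=f$ on morphisms; a dagger category is a category with a chosen dagger; a dagger functor is a functor commuting with daggers. $\mathbf{DagCat}$ is the category of small dagger categories and dagger functors, with its finite products. A dagger 2-category is a category enriched in $\mathbf{DagCat}$ (so each 2-cell $\phi\colon F\to G$ has a dagger $\phi^\dagger\colon G\to F$), and a dagger 2-functor is a $\mathbf{DagCat}$-enriched functor. An adjunction in a dagger 2-category is an adjunction in the underlying 2-category. A dagger 2-adjunction consists of two $\mathbf{DagCat}$-enriched functors that form a 2-adjunction in the usual sense. Let $\mathbf{C}$ be a dagger 2-category. A dagger Frobenius monad in $\mathbf{C}$ consists of an object $C$, a morphism $T\colon C\to C$, and 2-cells $\eta\colon\mathrm{id}_C\to T$, $\mu\colon T^2\to T$ forming a monad in the underlying 2-category and satisfying $\mu T\circ T\mu^\dagger=T\mu\circ\mu^\dagger T$. A morphism of dagger Frobenius monads $(C,S)\to(D,T)$ is a morphism $F\colon C\to D$ with a 2-cell $\sigma\colon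 TF\to FS$ such that (1) $\sigma\circ\eta^TF=F\eta^S$; (2) $\sigma\circ\mu^TF=F\mu^S\circ\sigma S\circ T\sigma$; (3) $\sigma^\dagger\circ F\mu^S\circ\sigma S=\mu^TF\circ T\sigma^\dagger$. Composition is $(G,\tau)\circ(F,\sigma)=(GF,\,G\sigma\circ\tau F)$. A transformation $(F,\sigma)\to(G,\tau)$ between such morphisms $(C,S)\to(D,T)$ is a 2-cell $\phi\colon F\to G$ with $\tau\circ T\phi=\phi S\circ\sigma$ and $\sigma\circ T\phi^\dagger=\phi^\dagger S\circ\tau$. With the compositions and dagger of 2-cells of $\mathbf{C}$, this forms a dagger 2-category $\mathrm{DFMonad}(\mathbf{C})$. There is an inclusion dagger 2-functor $\mathbf{C}\to\mathrm{DFMonad}(\mathbf{C})$ given by $C\mapsto(C,\mathrm{id}_C)$, $F\mapsto(F,\mathrm{id})$, $\psi\mapsto\psi$. The dagger 2-category $\mathbf{C}$ admits the construction of FEM-algebras when this inclusion has a right adjoint $\mathrm{FEM}\colon\mathrm{DFMonad}(\mathbf{C})\to\mathbf{C}$ (in the sense of a dagger 2-adjunction). *)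

theory Defs
  imports Main
begin

section \<open>Dagger categories and dagger functors\<close>

record ('a, 'f) dagcat =
  Obj :: "'a set"
  Arr :: "'f set"
  Dom :: "'f \<Rightarrow> 'a"
  Cod :: "'f \<Rightarrow> 'a"
  Ide :: "'a \<Rightarrow> 'f"
  Comp :: "'f \<Rightarrow> 'f \<Rightarrow> 'f"
  Dag :: "'f \<Rightarrow> 'f"

definition arrs :: "('a, 'f) dagcat \<Rightarrow> 'a \<Rightarrow> 'a \<Rightarrow> 'f set" where
  "arrs X a b = {f \<in> Arr X. Dom X f = a \<and> Cod X f = b}"

definition dagger_category :: "('a, 'f) dagcat \<Rightarrow> bool" where
  "dagger_category X \<longleftrightarrow>
     (\<forall>f\<in>Arr X. Dom X f \<in> Obj X \<and> Cod X f \<in> Obj X) \<and>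
     (\<forall>a\<in>Obj X. Ide X a \<in> arrs X a a) \<and>
     (\<forall>a\<in>Obj X. \<forall>b\<in>Obj X. \<forall>c\<in>Obj X. \<forall>f\<in>arrs X a b. \<forall>g\<in>arrs X b c. Comp X g f \<in> arrs X a c) \<and>
     (\<forall>a\<in>Obj X. \<forall>b\<in>Obj X. \<forall>f\<in>arrs X a b. Comp X f (Ide X a) = f \<and> Comp X (Ide X b) f = f) \<and>
     (\<forall>a\<in>Obj X. \<forall>b\<in>Obj X. \<forall>c\<in>Obj X. \<forall>d\<in>Obj X. \<forall>f\<in>arrs X a b. \<forall>g\<in>arrs X b c. \<forall>h\<in>arrs X c d.
        Comp X (Comp X h g) f = Comp X h (Comp X g f)) \<and>
     (\<forall>a\<in>Obj X. \<forall>b\<in>Obj X. \<forall>f\<in>arrs X a b. Dag X f \<in> arrs X b a \<and> Dag X (Dag X f) = f) \<and>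
     (\<forall>a\<in>Obj X. Dag X (Ide X a) = Ide X a) \<and>
     (\<forall>a\<in>Obj X. \<forall>b\<in>Obj X. \<forall>c\<in>Obj X. \<forall>f\<in>arrs X a b. \<forall>g\<in>arrs X b c.
        Dag X (Comp X g f) = Comp X (Dag X f) (Dag X g))"

record ('a, 'f, 'b, 'g) func =
  FObj :: "'a \<Rightarrow> 'b"
  FArr :: "'f \<Rightarrow> 'g"

definition dagger_functor ::
  "('a, 'f) dagcat \<Rightarrow> ('b, 'g) dagcat \<Rightarrow> ('a, 'f, 'b, 'g) func \<Rightarrow> bool" where
  "dagger_functor X Y F \<longleftrightarrow>
     (\<forall>a\<in>Obj X. FObj F a \<in> Obj Y) \<and>
     (\<forall>a\<in>Obj X. \<forall>b\<in>Obj X. \<forall>f\<in>arrs X a b. FArr F f \<in> arrs Y (FObj F a) (FObj F b)) \<and>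
     (\<forall>a\<in>Obj X. FArr F (Ide X a) = Ide Y (FObj F a)) \<and>
     (\<forall>a\<in>Obj X. \<forall>b\<in>Obj X. \<forall>c\<in>Obj X. \<forall>f\<in>arrs X a b. \<forall>g\<in>arrs X b c.
        FArr F (Comp X g f) = Comp Y (FArr F g) (FArr F f)) \<and>
     (\<forall>a\<in>Obj X. \<forall>b\<in>Obj X. \<forall>f\<in>arrs X a b. FArr F (Dag X f) = Dag Y (FArr F f))"

definition prod_dagcat ::
  "('a, 'f) dagcat \<Rightarrow> ('b, 'g) dagcat \<Rightarrow> ('a \<times> 'b, 'f \<times> 'g) dagcat" where
  "prod_dagcat X Y =
     \<lparr> Obj = Obj X \<times> Obj Y,
       Arr = Arr X \<times> Arr Y,
       Dom = (\<lambda>(f, g). (Dom X f, Dom Y g)),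
       Cod = (\<lambda>(f, g). (Cod X f, Cod Y g)),
       Ide = (\<lambda>(a, b). (Ide X a, Ide Y b)),
       Comp = (\<lambda>(f', g') (f, g). (Comp X f' f, Comp Y g' g)),
       Dag = (\<lambda>(f, g). (Dag X f, Dag Y g)) \<rparr>"

section \<open>Dagger 2-categories\<close>

text \<open>A category enriched in \<open>DagCat\<close>. The unit \<open>1 \<rightarrow> Hom A A\<close> is given by the object
  \<open>Unit A\<close> that it picks out (on the arrow of \<open>1\<close> it is forced to be the identity);
  \<open>HComp A B C\<close> is the composition functor \<open>Hom B C \<times> Hom A B \<rightarrow> Hom A C\<close>. The hom
  categories of different pairs of objects need not be disjoint, hence the indices.\<close>

record ('o, 'm, 'c) two_cat =
  Ob :: "'o set"
  Hom :: "'o \<Rightarrow> 'o \<Rightarrow> ('m, 'c) dagcat"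
  Unit :: "'o \<Rightarrow> 'm"
  HComp :: "'o \<Rightarrow> 'o \<Rightarrow> 'o \<Rightarrow> ('m \<times> 'm, 'c \<times> 'c, 'm, 'c) func"

abbreviation Mor :: "('o, 'm, 'c) two_cat \<Rightarrow> 'o \<Rightarrow> 'o \<Rightarrow> 'm set" where
  "Mor K A B \<equiv> Obj (Hom K A B)"

abbreviation Cell :: "('o, 'm, 'c) two_cat \<Rightarrow> 'o \<Rightarrow> 'o \<Rightarrow> 'm \<Rightarrow> 'm \<Rightarrow> 'c set" where
  "Cell K A B F G \<equiv> arrs (Hom K A B) F G"

abbreviation id2 :: "('o, 'm, 'c) two_cat \<Rightarrow> 'o \<Rightarrow> 'o \<Rightarrow> 'm \<Rightarrow> 'c" where
  "id2 K A B F \<equiv> Ide (Hom K A B) F"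

abbreviation vcomp :: "('o, 'm, 'c) two_cat \<Rightarrow> 'o \<Rightarrow> 'o \<Rightarrow> 'c \<Rightarrow> 'c \<Rightarrow> 'c" where
  "vcomp K A B \<psi> \<phi> \<equiv> Comp (Hom K A B) \<psi> \<phi>"

abbreviation dag2 :: "('o, 'm, 'c) two_cat \<Rightarrow> 'o \<Rightarrow> 'o \<Rightarrow> 'c \<Rightarrow> 'c" where
  "dag2 K A B \<phi> \<equiv> Dag (Hom K A B) \<phi>"

text \<open>Horizontal composition is written in functional order: for \<open>F : A \<rightarrow> B\<close> and
  \<open>G : B \<rightarrow> C\<close>, \<open>comp1 K A B C G F\<close> is \<open>GF\<close>, and the whiskerings \<open>G\<phi>\<close> and \<open>\<psi>F\<close>
  are \<open>lwhisk K A B C G \<phi>\<close> and \<open>rwhisk K A B C \<psi> F\<close>.\<close>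

abbreviation comp1 :: "('o, 'm, 'c) two_cat \<Rightarrow> 'o \<Rightarrow> 'o \<Rightarrow> 'o \<Rightarrow> 'm \<Rightarrow> 'm \<Rightarrow> 'm" where
  "comp1 K A B C G F \<equiv> FObj (HComp K A B C) (G, F)"

abbreviation hcomp :: "('o, 'm, 'c) two_cat \<Rightarrow> 'o \<Rightarrow> 'o \<Rightarrow> 'o \<Rightarrow> 'c \<Rightarrow> 'c \<Rightarrow> 'c" where
  "hcomp K A B C \<psi> \<phi> \<equiv> FArr (HComp K A B C) (\<psi>, \<phi>)"

abbreviation lwhisk :: "('o, 'm, 'c) two_cat \<Rightarrow> 'o \<Rightarrow> 'o \<Rightarrow> 'o \<Rightarrow> 'm \<Rightarrow> 'c \<Rightarrow> 'c" where
  "lwhisk K A B C G \<phi> \<equiv> hcomp K A B C (id2 K B C G) \<phi>"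

abbreviation rwhisk :: "('o, 'm, 'c) two_cat \<Rightarrow> 'o \<Rightarrow> 'o \<Rightarrow> 'o \<Rightarrow> 'c \<Rightarrow> 'm \<Rightarrow> 'c" where
  "rwhisk K A B C \<psi> F \<equiv> hcomp K A B C \<psi> (id2 K A B F)"

definition dagger_2category :: "('o, 'm, 'c) two_cat \<Rightarrow> bool" where
  "dagger_2category K \<longleftrightarrow>
     (\<forall>A\<in>Ob K. \<forall>B\<in>Ob K. dagger_category (Hom K A B)) \<and>
     (\<forall>A\<in>Ob K. Unit K A \<in> Mor K A A) \<and>
     (\<forall>A\<in>Ob K. \<forall>B\<in>Ob K. \<forall>C\<in>Ob K.
        dagger_functor (prod_dagcat (Hom K B C) (Hom K A B)) (Hom K A C) (HComp K A B C)) \<and>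
     (\<forall>A\<in>Ob K. \<forall>B\<in>Ob K. \<forall>C\<in>Ob K. \<forall>D\<in>Ob K.
        (\<forall>F\<in>Mor K A B. \<forall>G\<in>Mor K B C. \<forall>H\<in>Mor K C D.
           comp1 K A B D (comp1 K B C D H G) F = comp1 K A C D H (comp1 K A B C G F)) \<and>
        (\<forall>\<phi>\<in>Arr (Hom K A B). \<forall>\<psi>\<in>Arr (Hom K B C). \<forall>\<chi>\<in>Arr (Hom K C D).
           hcomp K A B D (hcomp K B C D \<chi> \<psi>) \<phi> = hcomp K A C D \<chi> (hcomp K A B C \<psi> \<phi>))) \<and>
     (\<forall>A\<in>Ob K. \<forall>B\<in>Ob K.
        (\<forall>F\<in>Mor K A B. comp1 K A A B F (Unit K A) = F \<and> comp1 K A B B (Unit K B) F = F) \<and>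
        (\<forall>\<phi>\<in>Arr (Hom K A B).
           rwhisk K A A B \<phi> (Unit K A) = \<phi> \<and> lwhisk K A B B (Unit K B) \<phi> = \<phi>))"

record ('o, 'm, 'c, 'p, 'n, 'd) two_func =
  TObj :: "'o \<Rightarrow> 'p"
  THom :: "'o \<Rightarrow> 'o \<Rightarrow> ('m, 'c, 'n, 'd) func"

abbreviation TMor :: "('o, 'm, 'c, 'p, 'n, 'd) two_func \<Rightarrow> 'o \<Rightarrow> 'o \<Rightarrow> 'm \<Rightarrow> 'n" where
  "TMor L A B F \<equiv> FObj (THom L A B) F"

abbreviation TCell :: "('o, 'm, 'c, 'p, 'n, 'd) two_func \<Rightarrow> 'o \<Rightarrow> 'o \<Rightarrow> 'c \<Rightarrow> 'd" where
  "TCell L A B \<phi> \<equiv> FArr (THom L A B) \<phi>"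

definition dagger_2functor ::
  "('o, 'm, 'c) two_cat \<Rightarrow> ('p, 'n, 'd) two_cat \<Rightarrow> ('o, 'm, 'c, 'p, 'n, 'd) two_func \<Rightarrow> bool" where
  "dagger_2functor K K' L \<longleftrightarrow>
     (\<forall>A\<in>Ob K. TObj L A \<in> Ob K') \<and>
     (\<forall>A\<in>Ob K. \<forall>B\<in>Ob K.
        dagger_functor (Hom K A B) (Hom K' (TObj L A) (TObj L B)) (THom L A B)) \<and>
     (\<forall>A\<in>Ob K. TMor L A A (Unit K A) = Unit K' (TObj L A)) \<and>
     (\<forall>A\<in>Ob K. \<forall>B\<in>Ob K. \<forall>C\<in>Ob K.
        (\<forall>F\<in>Mor K A B. \<forall>G\<in>Mor K B C.
           TMor L A C (comp1 K A B C G F)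
             = comp1 K' (TObj L A) (TObj L B) (TObj L C) (TMor L B C G) (TMor L A B F)) \<and>
        (\<forall>\<phi>\<in>Arr (Hom K A B). \<forall>\<psi>\<in>Arr (Hom K B C).
           TCell L A C (hcomp K A B C \<psi> \<phi>)
             = hcomp K' (TObj L A) (TObj L B) (TObj L C) (TCell L B C \<psi>) (TCell L A B \<phi>)))"

section \<open>Dagger 2-adjunctions\<close>

definition id_2functor :: "('o, 'm, 'c, 'o, 'm, 'c) two_func" where
  "id_2functor = \<lparr> TObj = (\<lambda>A. A), THom = (\<lambda>A B. \<lparr> FObj = (\<lambda>F. F), FArr = (\<lambda>\<phi>. \<phi>) \<rparr>) \<rparr>"

definition comp_2functor ::
  "('p, 'n, 'd, 'q, 'l, 'e) two_func \<Rightarrow> ('o, 'm, 'c, 'p, 'n, 'd) two_func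
     \<Rightarrow> ('o, 'm, 'c, 'q, 'l, 'e) two_func" where
  "comp_2functor R L =
     \<lparr> TObj = (\<lambda>A. TObj R (TObj L A)),
       THom = (\<lambda>A B. \<lparr> FObj = (\<lambda>F. TMor R (TObj L A) (TObj L B) (TMor L A B F)),
                      FArr = (\<lambda>\<phi>. TCell R (TObj L A) (TObj L B) (TCell L A B \<phi>)) \<rparr>) \<rparr>"

text \<open>Strict naturality, for 1-cells and for 2-cells: a \<open>DagCat\<close>-enriched natural
  transformation.\<close>

definition two_natural ::
  "('o, 'm, 'c) two_cat \<Rightarrow> ('p, 'n, 'd) two_cat \<Rightarrow> ('o, 'm, 'c, 'p, 'n, 'd) two_func
     \<Rightarrow> ('o, 'm, 'c, 'p, 'n, 'd) two_func \<Rightarrow> ('o \<Rightarrow> 'n) \<Rightarrow> bool" where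
  "two_natural K K' L M \<alpha> \<longleftrightarrow>
     (\<forall>A\<in>Ob K. \<alpha> A \<in> Mor K' (TObj L A) (TObj M A)) \<and>
     (\<forall>A\<in>Ob K. \<forall>B\<in>Ob K.
        (\<forall>F\<in>Mor K A B.
           comp1 K' (TObj L A) (TObj M A) (TObj M B) (TMor M A B F) (\<alpha> A)
             = comp1 K' (TObj L A) (TObj L B) (TObj M B) (\<alpha> B) (TMor L A B F)) \<and>
        (\<forall>\<phi>\<in>Arr (Hom K A B).
           rwhisk K' (TObj L A) (TObj M A) (TObj M B) (TCell M A B \<phi>) (\<alpha> A)
             = lwhisk K' (TObj L A) (TObj L B) (TObj M B) (\<alpha> B) (TCell L A B \<phi>)))"

text \<open>\<open>L\<close> is left adjoint to \<open>R\<close>, with unit \<open>u\<close> and counit \<open>e\<close>; the triangle identities are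
  equalities of 1-cells.\<close>

definition dagger_2adjunction ::
  "('o, 'm, 'c) two_cat \<Rightarrow> ('p, 'n, 'd) two_cat \<Rightarrow> ('o, 'm, 'c, 'p, 'n, 'd) two_func
     \<Rightarrow> ('p, 'n, 'd, 'o, 'm, 'c) two_func \<Rightarrow> ('o \<Rightarrow> 'm) \<Rightarrow> ('p \<Rightarrow> 'n) \<Rightarrow> bool" where
  "dagger_2adjunction K K' L R u e \<longleftrightarrow>
     dagger_2functor K K' L \<and> dagger_2functor K' K R \<and>
     two_natural K K id_2functor (comp_2functor R L) u \<and>
     two_natural K' K' (comp_2functor L R) id_2functor e \<and>
     (\<forall>A\<in>Ob K.
        comp1 K' (TObj L A) (TObj L (TObj R (TObj L A))) (TObj L A)
          (e (TObj L A)) (TMor L A (TObj R (TObj L A)) (u A)) = Unit K' (TObj L A)) \<and>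
     (\<forall>X\<in>Ob K'.
        comp1 K (TObj R X) (TObj R (TObj L (TObj R X))) (TObj R X)
          (TMor R (TObj L (TObj R X)) X (e X)) (u (TObj R X)) = Unit K (TObj R X))"

section \<open>Dagger Frobenius monads\<close>

record ('o, 'm, 'c) monad_data =
  mbase :: 'o
  mendo :: 'm
  munit :: 'c
  mmult :: 'c

definition dagger_Frobenius_monad ::
  "('o, 'm, 'c) two_cat \<Rightarrow> ('o, 'm, 'c) monad_data \<Rightarrow> bool" where
  "dagger_Frobenius_monad K M \<longleftrightarrow>
     (let C = mbase M; T = mendo M; \<eta> = munit M; \<mu> = mmult M; \<mu>' = dag2 K C C \<mu> in
        C \<in> Ob K \<and> T \<in> Mor K C C \<and>
        \<eta> \<in> Cell K C C (Unit K C) T \<and>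
        \<mu> \<in> Cell K C C (comp1 K C C C T T) T \<and>
        vcomp K C C \<mu> (lwhisk K C C C T \<mu>) = vcomp K C C \<mu> (rwhisk K C C C \<mu> T) \<and>
        vcomp K C C \<mu> (lwhisk K C C C T \<eta>) = id2 K C C T \<and>
        vcomp K C C \<mu> (rwhisk K C C C \<eta> T) = id2 K C C T \<and>
        vcomp K C C (rwhisk K C C C \<mu> T) (lwhisk K C C C T \<mu>')
          = vcomp K C C (lwhisk K C C C T \<mu>) (rwhisk K C C C \<mu>' T))"

definition dfm_morphism ::
  "('o, 'm, 'c) two_cat \<Rightarrow> ('o, 'm, 'c) monad_data \<Rightarrow> ('o, 'm, 'c) monad_data
     \<Rightarrow> 'm \<times> 'c \<Rightarrow> bool" where
  "dfm_morphism K M N p \<longleftrightarrow>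
     (let C = mbase M; S = mendo M; D = mbase N; T = mendo N; F = fst p; \<sigma> = snd p;
          \<sigma>' = dag2 K C D \<sigma> in
        F \<in> Mor K C D \<and>
        \<sigma> \<in> Cell K C D (comp1 K C D D T F) (comp1 K C C D F S) \<and>
        vcomp K C D \<sigma> (rwhisk K C D D (munit N) F) = lwhisk K C C D F (munit M) \<and>
        vcomp K C D \<sigma> (rwhisk K C D D (mmult N) F)
          = vcomp K C D (lwhisk K C C D F (mmult M))
              (vcomp K C D (rwhisk K C C D \<sigma> S) (lwhisk K C D D T \<sigma>)) \<and>
        vcomp K C D \<sigma>' (vcomp K C D (lwhisk K C C D F (mmult M)) (rwhisk K C C D \<sigma> S))
          = vcomp K C D (rwhisk K C D D (mmult N) F) (lwhisk K C D D T \<sigma>'))"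

definition dfm_transformation ::
  "('o, 'm, 'c) two_cat \<Rightarrow> ('o, 'm, 'c) monad_data \<Rightarrow> ('o, 'm, 'c) monad_data
     \<Rightarrow> 'm \<times> 'c \<Rightarrow> 'm \<times> 'c \<Rightarrow> 'c \<Rightarrow> bool" where
  "dfm_transformation K M N p q \<phi> \<longleftrightarrow>
     (let C = mbase M; S = mendo M; D = mbase N; T = mendo N;
          F = fst p; \<sigma> = snd p; G = fst q; \<tau> = snd q; \<phi>' = dag2 K C D \<phi> in
        \<phi> \<in> Cell K C D F G \<and>
        vcomp K C D \<tau> (lwhisk K C D D T \<phi>) = vcomp K C D (rwhisk K C C D \<phi> S) \<sigma> \<and>
        vcomp K C D \<sigma> (lwhisk K C D D T \<phi>') = vcomp K C D (rwhisk K C C D \<phi>' S) \<tau>)"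

text \<open>Since the same 2-cell may be a transformation between several pairs of morphisms, 2-cells
  of \<open>DFMonad K\<close> are triples (source, 2-cell of \<open>K\<close>, target).\<close>

type_synonym ('m, 'c) dfm_cell = "('m \<times> 'c) \<times> 'c \<times> ('m \<times> 'c)"

definition dfm_hom ::
  "('o, 'm, 'c) two_cat \<Rightarrow> ('o, 'm, 'c) monad_data \<Rightarrow> ('o, 'm, 'c) monad_data
     \<Rightarrow> ('m \<times> 'c, ('m, 'c) dfm_cell) dagcat" where
  "dfm_hom K M N =
     (let C = mbase M; D = mbase N in
     \<lparr> Obj = {p. dfm_morphism K M N p},
       Arr = {(p, \<phi>, q). dfm_morphism K M N p \<and> dfm_morphism K M N q
                           \<and> dfm_transformation K M N p q \<phi>},
       Dom = (\<lambda>(p, \<phi>, q). p),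
       Cod = (\<lambda>(p, \<phi>, q). q),
       Ide = (\<lambda>p. (p, id2 K C D (fst p), p)),
       Comp = (\<lambda>(q', \<psi>, r) (p, \<phi>, q). (p, vcomp K C D \<psi> \<phi>, r)),
       Dag = (\<lambda>(p, \<phi>, q). (q, dag2 K C D \<phi>, p)) \<rparr>)"

definition dfm_comp1 ::
  "('o, 'm, 'c) two_cat \<Rightarrow> 'o \<Rightarrow> 'o \<Rightarrow> 'o \<Rightarrow> 'm \<times> 'c \<Rightarrow> 'm \<times> 'c \<Rightarrow> 'm \<times> 'c" where
  "dfm_comp1 K C D E = (\<lambda>(G, \<tau>) (F, \<sigma>).
     (comp1 K C D E G F, vcomp K C E (lwhisk K C D E G \<sigma>) (rwhisk K C D E \<tau> F)))"

definition DFMonad ::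
  "('o, 'm, 'c) two_cat
     \<Rightarrow> (('o, 'm, 'c) monad_data, 'm \<times> 'c, ('m, 'c) dfm_cell) two_cat" where
  "DFMonad K =
     \<lparr> Ob = {M. dagger_Frobenius_monad K M},
       Hom = dfm_hom K,
       Unit = (\<lambda>M. (Unit K (mbase M), id2 K (mbase M) (mbase M) (mendo M))),
       HComp = (\<lambda>M N P. let C = mbase M; D = mbase N; E = mbase P in
         \<lparr> FObj = (\<lambda>(q, p). dfm_comp1 K C D E q p),
           FArr = (\<lambda>((q, \<psi>, q'), (p, \<phi>, p')).
             (dfm_comp1 K C D E q p, hcomp K C D E \<psi> \<phi>, dfm_comp1 K C D E q' p')) \<rparr>) \<rparr>"

definition trivial_monad :: "('o, 'm, 'c) two_cat \<Rightarrow> 'o \<Rightarrow> ('o, 'm, 'c) monad_data" where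
  "trivial_monad K C =
     (let i = id2 K C C (Unit K C) in
      \<lparr> mbase = C, mendo = Unit K C, munit = i, mmult = i \<rparr>)"

definition dfm_inclusion ::
  "('o, 'm, 'c) two_cat
     \<Rightarrow> ('o, 'm, 'c, ('o, 'm, 'c) monad_data, 'm \<times> 'c, ('m, 'c) dfm_cell) two_func" where
  "dfm_inclusion K =
     \<lparr> TObj = trivial_monad K,
       THom = (\<lambda>A B. \<lparr> FObj = (\<lambda>F. (F, id2 K A B F)),
                      FArr = (\<lambda>\<psi>. let F = Dom (Hom K A B) \<psi>; G = Cod (Hom K A B) \<psi> in
                                ((F, id2 K A B F), \<psi>, (G, id2 K A B G))) \<rparr>) \<rparr>"

definition admits_FEM_algebras :: "('o, 'm, 'c) two_cat \<Rightarrow> bool" where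
  "admits_FEM_algebras K \<longleftrightarrow>
     (\<exists>FEM u e. dagger_2adjunction K (DFMonad K) (dfm_inclusion K) FEM u e)"

section \<open>Adjunctions in a dagger 2-category\<close>

definition adjunction_in ::
  "('o, 'm, 'c) two_cat \<Rightarrow> 'o \<Rightarrow> 'o \<Rightarrow> 'm \<Rightarrow> 'm \<Rightarrow> 'c \<Rightarrow> 'c \<Rightarrow> bool" where
  "adjunction_in K C D J E \<eta> \<epsilon> \<longleftrightarrow>
     C \<in> Ob K \<and> D \<in> Ob K \<and> J \<in> Mor K C D \<and> E \<in> Mor K D C \<and>
     \<eta> \<in> Cell K C C (Unit K C) (comp1 K C D C E J) \<and>
     \<epsilon> \<in> Cell K D D (comp1 K D C D J E) (Unit K D) \<and>
     vcomp K C D (rwhisk K C D D \<epsilon> J) (lwhisk K C C D J \<eta>) = id2 K C D J \<and>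
     vcomp K D C (lwhisk K D D C E \<epsilon>) (rwhisk K D C C \<eta> E) = id2 K D C E"

definition induced_monad ::
  "('o, 'm, 'c) two_cat \<Rightarrow> 'o \<Rightarrow> 'o \<Rightarrow> 'm \<Rightarrow> 'm \<Rightarrow> 'c \<Rightarrow> 'c \<Rightarrow> ('o, 'm, 'c) monad_data" where
  "induced_monad K C D J E \<eta> \<epsilon> =
     \<lparr> mbase = C, mendo = comp1 K C D C E J, munit = \<eta>,
       mmult = lwhisk K C D C E (rwhisk K C D D \<epsilon> J) \<rparr>"

end

theory Submission
  imports Defs
begin

text \<open>The counit of the dagger 2-adjunction at \<open>(C, T)\<close> is a universal FEM-algebra
  \<open>\<sigma> : TE \<rightarrow> E\<close> with \<open>E : D \<rightarrow> C\<close>. The Frobenius law makes \<open>\<mu> : T\<^sup>2 \<rightarrow> T\<close> a FEM-algebra on \<open>T : C \<rightarrow> C\<close>,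
  so universality for 1-cells gives \<open>J : C \<rightarrow> D\<close> with \<open>EJ = T\<close> and \<open>\<sigma>J = \<mu>\<close>. The action \<open>\<sigma>\<close> is itself
  a transformation of algebras \<open>(TE, \<mu>E) \<rightarrow> (E, \<sigma>)\<close>, so universality for 2-cells gives
  \<open>\<epsilon> : JE \<rightarrow> 1\<close> with \<open>E\<epsilon> = \<sigma>\<close>; hence \<open>E\<epsilon>J = \<mu>\<close>. One triangle identity is the unit law of \<open>\<sigma>\<close>, the
  other becomes a unit law of \<open>T\<close> after applying \<open>E\<close>, which is faithful on 2-cells into \<open>D\<close>.\<close>

section \<open>Calculus of 2-cells in a dagger 2-category\<close>

locale dagger_2cat =
  fixes K :: "('o, 'm, 'c) two_cat"
  assumes is_dagger_2category: "dagger_2category K"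
begin

text \<open>A 2-cell is typed below by membership in \<open>Arr2\<close> together with equations for
  \<open>src\<close> and \<open>tgt\<close> rather than by membership in \<open>Cell\<close>, so
  that the simplifier can compute boundaries and discharge composability conditions.\<close>

abbreviation Arr2 :: "'o \<Rightarrow> 'o \<Rightarrow> 'c set" where
  "Arr2 A B \<equiv> Arr (Hom K A B)"

abbreviation src :: "'o \<Rightarrow> 'o \<Rightarrow> 'c \<Rightarrow> 'm" where
  "src A B \<equiv> Dom (Hom K A B)"

abbreviation tgt :: "'o \<Rightarrow> 'o \<Rightarrow> 'c \<Rightarrow> 'm" where
  "tgt A B \<equiv> Cod (Hom K A B)"

lemma hom: "A \<in> Ob K \<Longrightarrow> B \<in> Ob K \<Longrightarrow> dagger_category (Hom K A B)"
  using is_dagger_2category by (simp add: dagger_2category_def)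

lemma hcomp_functor:
  "A \<in> Ob K \<Longrightarrow> B \<in> Ob K \<Longrightarrow> C \<in> Ob K \<Longrightarrow>
    dagger_functor (prod_dagcat (Hom K B C) (Hom K A B)) (Hom K A C) (HComp K A B C)"
  using is_dagger_2category by (simp add: dagger_2category_def)

lemma arr_boundary [simp]:
  assumes "A \<in> Ob K" "B \<in> Ob K" "\<phi> \<in> Arr2 A B"
  shows "src A B \<phi> \<in> Mor K A B" "tgt A B \<phi> \<in> Mor K A B"
  using hom[OF assms(1,2)] assms(3) by (auto simp: dagger_category_def)

lemma id2_simps [simp]:
  assumes "A \<in> Ob K" "B \<in> Ob K" "F \<in> Mor K A B"
  shows "id2 K A B F \<in> Arr2 A B" "src A B (id2 K A B F) = F" "tgt A B (id2 K A B F) = F"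
    "dag2 K A B (id2 K A B F) = id2 K A B F"
  using hom[OF assms(1,2)] assms(3) by (auto simp: dagger_category_def arrs_def)

lemma vcomp_simps [simp]:
  assumes "A \<in> Ob K" "B \<in> Ob K" "\<phi> \<in> Arr2 A B" "\<psi> \<in> Arr2 A B" "src A B \<psi> = tgt A B \<phi>"
  shows "vcomp K A B \<psi> \<phi> \<in> Arr2 A B"
    "src A B (vcomp K A B \<psi> \<phi>) = src A B \<phi>"
    "tgt A B (vcomp K A B \<psi> \<phi>) = tgt A B \<psi>"
    "dag2 K A B (vcomp K A B \<psi> \<phi>) = vcomp K A B (dag2 K A B \<phi>) (dag2 K A B \<psi>)"
proof -
  have "\<phi> \<in> arrs (Hom K A B) (src A B \<phi>) (tgt A B \<phi>)"
    "\<psi> \<in> arrs (Hom K A B) (tgt A B \<phi>) (tgt A B \<psi>)"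
    using assms by (auto simp: arrs_def)
  moreover have "src A B \<phi> \<in> Mor K A B" "tgt A B \<phi> \<in> Mor K A B" "tgt A B \<psi> \<in> Mor K A B"
    using assms by auto
  ultimately have "vcomp K A B \<psi> \<phi> \<in> arrs (Hom K A B) (src A B \<phi>) (tgt A B \<psi>)"
    "dag2 K A B (vcomp K A B \<psi> \<phi>) = vcomp K A B (dag2 K A B \<phi>) (dag2 K A B \<psi>)"
    using hom[OF assms(1,2)] unfolding dagger_category_def by meson+
  then show "vcomp K A B \<psi> \<phi> \<in> Arr2 A B"
    "src A B (vcomp K A B \<psi> \<phi>) = src A B \<phi>"
    "tgt A B (vcomp K A B \<psi> \<phi>) = tgt A B \<psi>"
    "dag2 K A B (vcomp K A B \<psi> \<phi>) = vcomp K A B (dag2 K A B \<phi>) (dag2 K A B \<psi>)"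
    by (auto simp: arrs_def)
qed

lemma vcomp_assoc [simp]:
  assumes "A \<in> Ob K" "B \<in> Ob K" "\<phi> \<in> Arr2 A B" "\<psi> \<in> Arr2 A B" "\<chi> \<in> Arr2 A B"
    "src A B \<psi> = tgt A B \<phi>" "src A B \<chi> = tgt A B \<psi>"
  shows "vcomp K A B (vcomp K A B \<chi> \<psi>) \<phi> = vcomp K A B \<chi> (vcomp K A B \<psi> \<phi>)"
proof -
  have "\<phi> \<in> arrs (Hom K A B) (src A B \<phi>) (tgt A B \<phi>)"
    "\<psi> \<in> arrs (Hom K A B) (tgt A B \<phi>) (tgt A B \<psi>)"
    "\<chi> \<in> arrs (Hom K A B) (tgt A B \<psi>) (tgt A B \<chi>)"
    using assms by (auto simp: arrs_def)
  moreover have "src A B \<phi> \<in> Mor K A B" "tgt A B \<phi> \<in> Mor K A B" "tgt A B \<psi> \<in> Mor K A B"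
    "tgt A B \<chi> \<in> Mor K A B"
    using assms by auto
  ultimately show ?thesis
    using hom[OF assms(1,2)] unfolding dagger_category_def by meson
qed

lemma vcomp_id [simp]:
  assumes "A \<in> Ob K" "B \<in> Ob K" "\<phi> \<in> Arr2 A B"
  shows "src A B \<phi> = F \<Longrightarrow> vcomp K A B \<phi> (id2 K A B F) = \<phi>"
    "tgt A B \<phi> = F \<Longrightarrow> vcomp K A B (id2 K A B F) \<phi> = \<phi>"
proof -
  have "\<phi> \<in> arrs (Hom K A B) (src A B \<phi>) (tgt A B \<phi>)"
    using assms by (auto simp: arrs_def)
  moreover have "src A B \<phi> \<in> Mor K A B" "tgt A B \<phi> \<in> Mor K A B"
    using assms by auto
  ultimately show "src A B \<phi> = F \<Longrightarrow> vcomp K A B \<phi> (id2 K A B F) = \<phi>"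
    "tgt A B \<phi> = F \<Longrightarrow> vcomp K A B (id2 K A B F) \<phi> = \<phi>"
    using hom[OF assms(1,2)] unfolding dagger_category_def by meson+
qed

lemma dag2_simps [simp]:
  assumes "A \<in> Ob K" "B \<in> Ob K" "\<phi> \<in> Arr2 A B"
  shows "dag2 K A B \<phi> \<in> Arr2 A B" "src A B (dag2 K A B \<phi>) = tgt A B \<phi>"
    "tgt A B (dag2 K A B \<phi>) = src A B \<phi>" "dag2 K A B (dag2 K A B \<phi>) = \<phi>"
proof -
  have "\<phi> \<in> arrs (Hom K A B) (src A B \<phi>) (tgt A B \<phi>)"
    using assms by (auto simp: arrs_def)
  moreover have "src A B \<phi> \<in> Mor K A B" "tgt A B \<phi> \<in> Mor K A B"
    using assms by auto
  ultimately have "dag2 K A B \<phi> \<in> arrs (Hom K A B) (tgt A B \<phi>) (src A B \<phi>)"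
    "dag2 K A B (dag2 K A B \<phi>) = \<phi>"
    using hom[OF assms(1,2)] unfolding dagger_category_def by meson+
  then show "dag2 K A B \<phi> \<in> Arr2 A B" "src A B (dag2 K A B \<phi>) = tgt A B \<phi>"
    "tgt A B (dag2 K A B \<phi>) = src A B \<phi>" "dag2 K A B (dag2 K A B \<phi>) = \<phi>"
    by (auto simp: arrs_def)
qed

lemma Unit_Mor [simp]: "A \<in> Ob K \<Longrightarrow> Unit K A \<in> Mor K A A"
  using is_dagger_2category by (simp add: dagger_2category_def)

lemma comp1_simps [simp]:
  assumes "A \<in> Ob K" "B \<in> Ob K" "C \<in> Ob K" "F \<in> Mor K A B" "G \<in> Mor K B C"
  shows "comp1 K A B C G F \<in> Mor K A C"
    "hcomp K A B C (id2 K B C G) (id2 K A B F) = id2 K A C (comp1 K A B C G F)"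
  using hcomp_functor[OF assms(1-3)] assms(4,5)
  by (auto simp: dagger_functor_def prod_dagcat_def)

lemma comp1_assoc [simp]:
  assumes "A \<in> Ob K" "B \<in> Ob K" "C \<in> Ob K" "D \<in> Ob K"
    "F \<in> Mor K A B" "G \<in> Mor K B C" "H \<in> Mor K C D"
  shows "comp1 K A B D (comp1 K B C D H G) F = comp1 K A C D H (comp1 K A B C G F)"
  using is_dagger_2category assms by (simp add: dagger_2category_def)

lemma comp1_Unit [simp]:
  assumes "A \<in> Ob K" "B \<in> Ob K" "F \<in> Mor K A B"
  shows "comp1 K A A B F (Unit K A) = F" "comp1 K A B B (Unit K B) F = F"
  using is_dagger_2category assms by (simp_all add: dagger_2category_def)

lemma hcomp_simps [simp]:
  assumes "A \<in> Ob K" "B \<in> Ob K" "C \<in> Ob K" "\<phi> \<in> Arr2 A B" "\<psi> \<in> Arr2 B C"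
  shows "hcomp K A B C \<psi> \<phi> \<in> Arr2 A C"
    "src A C (hcomp K A B C \<psi> \<phi>) = comp1 K A B C (src B C \<psi>) (src A B \<phi>)"
    "tgt A C (hcomp K A B C \<psi> \<phi>) = comp1 K A B C (tgt B C \<psi>) (tgt A B \<phi>)"
    "dag2 K A C (hcomp K A B C \<psi> \<phi>) = hcomp K A B C (dag2 K B C \<psi>) (dag2 K A B \<phi>)"
proof -
  let ?P = "prod_dagcat (Hom K B C) (Hom K A B)"
  let ?s = "(src B C \<psi>, src A B \<phi>)" and ?t = "(tgt B C \<psi>, tgt A B \<phi>)"
  have "(\<psi>, \<phi>) \<in> arrs ?P ?s ?t" "?s \<in> Obj ?P" "?t \<in> Obj ?P"
    using assms by (auto simp: arrs_def prod_dagcat_def)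
  then have "hcomp K A B C \<psi> \<phi> \<in> arrs (Hom K A C) (FObj (HComp K A B C) ?s) (FObj (HComp K A B C) ?t)"
    "FArr (HComp K A B C) (Dag ?P (\<psi>, \<phi>)) = dag2 K A C (hcomp K A B C \<psi> \<phi>)"
    using hcomp_functor[OF assms(1-3)] unfolding dagger_functor_def by meson+
  then show "hcomp K A B C \<psi> \<phi> \<in> Arr2 A C"
    "src A C (hcomp K A B C \<psi> \<phi>) = comp1 K A B C (src B C \<psi>) (src A B \<phi>)"
    "tgt A C (hcomp K A B C \<psi> \<phi>) = comp1 K A B C (tgt B C \<psi>) (tgt A B \<phi>)"
    "dag2 K A C (hcomp K A B C \<psi> \<phi>) = hcomp K A B C (dag2 K B C \<psi>) (dag2 K A B \<phi>)"
    by (auto simp: arrs_def prod_dagcat_def)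
qed

text \<open>Functoriality of \<open>HComp\<close> on a product of hom categories. It stays out of
  the simpset because it merges the whiskerings that \<open>lwhisk_vcomp\<close> and
  \<open>rwhisk_vcomp\<close> separate.\<close>

lemma interchange:
  assumes "A \<in> Ob K" "B \<in> Ob K" "C \<in> Ob K" "\<phi> \<in> Arr2 A B" "\<phi>' \<in> Arr2 A B"
    "\<psi> \<in> Arr2 B C" "\<psi>' \<in> Arr2 B C" "src A B \<phi>' = tgt A B \<phi>" "src B C \<psi>' = tgt B C \<psi>"
  shows "vcomp K A C (hcomp K A B C \<psi>' \<phi>') (hcomp K A B C \<psi> \<phi>)
    = hcomp K A B C (vcomp K B C \<psi>' \<psi>) (vcomp K A B \<phi>' \<phi>)"
proof -
  let ?P = "prod_dagcat (Hom K B C) (Hom K A B)"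
  let ?s = "(src B C \<psi>, src A B \<phi>)" and ?t = "(tgt B C \<psi>, tgt A B \<phi>)"
    and ?r = "(tgt B C \<psi>', tgt A B \<phi>')"
  have "(\<psi>, \<phi>) \<in> arrs ?P ?s ?t" "(\<psi>', \<phi>') \<in> arrs ?P ?t ?r"
    "?s \<in> Obj ?P" "?t \<in> Obj ?P" "?r \<in> Obj ?P"
    using assms by (auto simp: arrs_def prod_dagcat_def)
  then have "FArr (HComp K A B C) (Comp ?P (\<psi>', \<phi>') (\<psi>, \<phi>))
      = vcomp K A C (hcomp K A B C \<psi>' \<phi>') (hcomp K A B C \<psi> \<phi>)"
    using hcomp_functor[OF assms(1-3)] unfolding dagger_functor_def by meson
  then show ?thesis
    by (simp add: prod_dagcat_def)
qed

lemma hcomp_assoc [simp]: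
  assumes "A \<in> Ob K" "B \<in> Ob K" "C \<in> Ob K" "D \<in> Ob K"
    "\<phi> \<in> Arr2 A B" "\<psi> \<in> Arr2 B C" "\<chi> \<in> Arr2 C D"
  shows "hcomp K A B D (hcomp K B C D \<chi> \<psi>) \<phi> = hcomp K A C D \<chi> (hcomp K A B C \<psi> \<phi>)"
  using is_dagger_2category assms by (simp add: dagger_2category_def)

lemma whisk_Unit [simp]:
  assumes "A \<in> Ob K" "B \<in> Ob K" "\<phi> \<in> Arr2 A B"
  shows "rwhisk K A A B \<phi> (Unit K A) = \<phi>" "lwhisk K A B B (Unit K B) \<phi> = \<phi>"
  using is_dagger_2category assms by (simp_all add: dagger_2category_def)

text \<open>Oriented against \<open>hcomp_assoc\<close> on left whiskerings, so that the simplifier has a normal form: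
  \<open>(HG)\<phi>\<close> is split into successive whiskerings, while \<open>(\<phi>G)F\<close> is merged into \<open>\<phi>(GF)\<close>.\<close>

lemma lwhisk_comp1 [simp]:
  assumes "A \<in> Ob K" "B \<in> Ob K" "C \<in> Ob K" "D \<in> Ob K"
    "\<phi> \<in> Arr2 A B" "G \<in> Mor K B C" "H \<in> Mor K C D"
  shows "lwhisk K A B D (comp1 K B C D H G) \<phi> = lwhisk K A C D H (lwhisk K A B C G \<phi>)"
  using assms hcomp_assoc[of A B C D \<phi> "id2 K B C G" "id2 K C D H"] by simp

lemma lwhisk_vcomp [simp]:
  assumes "A \<in> Ob K" "B \<in> Ob K" "C \<in> Ob K" "\<phi> \<in> Arr2 A B" "\<psi> \<in> Arr2 A B" "G \<in> Mor K B C"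
    "src A B \<psi> = tgt A B \<phi>"
  shows "lwhisk K A B C G (vcomp K A B \<psi> \<phi>)
    = vcomp K A C (lwhisk K A B C G \<psi>) (lwhisk K A B C G \<phi>)"
  using assms by (simp add: interchange)

lemma rwhisk_vcomp [simp]:
  assumes "A \<in> Ob K" "B \<in> Ob K" "C \<in> Ob K" "\<phi> \<in> Arr2 B C" "\<psi> \<in> Arr2 B C" "F \<in> Mor K A B"
    "src B C \<psi> = tgt B C \<phi>"
  shows "rwhisk K A B C (vcomp K B C \<psi> \<phi>) F
    = vcomp K A C (rwhisk K A B C \<psi> F) (rwhisk K A B C \<phi> F)"
  using assms by (simp add: interchange)

text \<open>By interchange both sides are the horizontal composite of \<psi> and \<phi>. This is the
  source of every sliding step in the Frobenius computation.\<close>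

lemma whisk_exchange:
  assumes "A \<in> Ob K" "B \<in> Ob K" "C \<in> Ob K" "\<phi> \<in> Arr2 A B" "\<psi> \<in> Arr2 B C"
  shows "vcomp K A C (lwhisk K A B C (tgt B C \<psi>) \<phi>) (rwhisk K A B C \<psi> (src A B \<phi>))
    = vcomp K A C (rwhisk K A B C \<psi> (tgt A B \<phi>)) (lwhisk K A B C (src B C \<psi>) \<phi>)"
  using assms by (simp add: interchange)

lemma Cell_iff:
  "\<phi> \<in> Cell K A B F G \<longleftrightarrow> \<phi> \<in> Arr2 A B \<and> src A B \<phi> = F \<and> tgt A B \<phi> = G"
  by (simp add: arrs_def)

lemma trivial_monad_simps [simp]:
  "mbase (trivial_monad K A) = A" "mendo (trivial_monad K A) = Unit K A"
  "munit (trivial_monad K A) = id2 K A A (Unit K A)"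
  "mmult (trivial_monad K A) = id2 K A A (Unit K A)"
  by (simp_all add: trivial_monad_def Let_def)

section \<open>FEM-algebras as 1-cells out of trivial monads\<close>

text \<open>Whiskering with the identity monad disappears, and the three conditions on a morphism
  become the unit, associativity and Frobenius laws of an action of \<open>T\<close> on
  \<open>F\<close>: a FEM-algebra with domain \<open>A\<close>.\<close>

lemma dfm_morphism_trivial_iff:
  assumes A: "A \<in> Ob K" and M: "dagger_Frobenius_monad K M"
  defines "C \<equiv> mbase M" and "T \<equiv> mendo M"
  shows "dfm_morphism K (trivial_monad K A) M (F, \<sigma>) \<longleftrightarrow>
    F \<in> Mor K A C \<and> \<sigma> \<in> Cell K A C (comp1 K A C C T F) F \<and>
    vcomp K A C \<sigma> (rwhisk K A C C (munit M) F) = id2 K A C F \<and>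
    vcomp K A C \<sigma> (rwhisk K A C C (mmult M) F) = vcomp K A C \<sigma> (lwhisk K A C C T \<sigma>) \<and>
    vcomp K A C (dag2 K A C \<sigma>) \<sigma>
      = vcomp K A C (rwhisk K A C C (mmult M) F) (lwhisk K A C C T (dag2 K A C \<sigma>))"
  using A M unfolding dfm_morphism_def dagger_Frobenius_monad_def C_def T_def
  by (auto simp: Let_def Cell_iff)

text \<open>In terms of algebras: a homomorphism whose dagger is a homomorphism in the other
  direction.\<close>

lemma dfm_transformation_trivial_iff:
  assumes A: "A \<in> Ob K" and M: "dagger_Frobenius_monad K M"
  defines "C \<equiv> mbase M" and "T \<equiv> mendo M"
  shows "dfm_transformation K (trivial_monad K A) M (F, \<sigma>) (G, \<tau>) \<phi> \<longleftrightarrow>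
    \<phi> \<in> Cell K A C F G \<and>
    vcomp K A C \<tau> (lwhisk K A C C T \<phi>) = vcomp K A C \<phi> \<sigma> \<and>
    vcomp K A C \<sigma> (lwhisk K A C C T (dag2 K A C \<phi>)) = vcomp K A C (dag2 K A C \<phi>) \<tau>"
  using A M unfolding dfm_transformation_def dagger_Frobenius_monad_def C_def T_def
  by (auto simp: Let_def Cell_iff)

text \<open>\<open>dagger_2adjunction\<close> carries no 2-category axioms for
  \<open>DFMonad K\<close>, so the laws applied together with it are derived from those of
  \<open>K\<close>. Here both bracketings have the same threefold vertical composite as normal form
  of their 2-cell.\<close>

lemma dfm_comp1_assoc:
  assumes "dagger_Frobenius_monad K M" "dagger_Frobenius_monad K N"
    "dagger_Frobenius_monad K P" "dagger_Frobenius_monad K Q"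
    "dfm_morphism K M N f" "dfm_morphism K N P g" "dfm_morphism K P Q h"
  shows "dfm_comp1 K (mbase M) (mbase N) (mbase Q)
      (dfm_comp1 K (mbase N) (mbase P) (mbase Q) h g) f
    = dfm_comp1 K (mbase M) (mbase P) (mbase Q) h
      (dfm_comp1 K (mbase M) (mbase N) (mbase P) g f)"
  using assms unfolding dfm_morphism_def dagger_Frobenius_monad_def dfm_comp1_def
  by (auto simp: Let_def Cell_iff split: prod.splits)

lemma dfm_comp1_Unit:
  assumes "dagger_Frobenius_monad K M" "dagger_Frobenius_monad K N" "dfm_morphism K M N f"
  shows "dfm_comp1 K (mbase M) (mbase M) (mbase N) f
      (Unit K (mbase M), id2 K (mbase M) (mbase M) (mendo M)) = f"
  using assms unfolding dfm_morphism_def dagger_Frobenius_monad_def dfm_comp1_def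
  by (auto simp: Let_def Cell_iff split: prod.splits)

text \<open>Restriction of an algebra along \<open>H\<close>: each of its laws is whiskered with
  \<open>H\<close> on the right and normalised.\<close>

lemma dfm_morphism_rwhisk:
  assumes A: "A \<in> Ob K" and B: "B \<in> Ob K" and M: "dagger_Frobenius_monad K M"
    and p: "dfm_morphism K (trivial_monad K B) M (F, \<sigma>)" and H: "H \<in> Mor K A B"
  defines "C \<equiv> mbase M"
  shows "dfm_morphism K (trivial_monad K A) M (comp1 K A B C F H, rwhisk K A B C \<sigma> H)"
proof -
  let ?T = "mendo M" and ?\<eta> = "munit M" and ?\<mu> = "mmult M"
  have C: "C \<in> Ob K" "?T \<in> Mor K C C" and \<eta>: "?\<eta> \<in> Arr2 C C" "src C C ?\<eta> = Unit K C" "tgt C C ?\<eta> = ?T"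
    and \<mu>: "?\<mu> \<in> Arr2 C C" "src C C ?\<mu> = comp1 K C C C ?T ?T" "tgt C C ?\<mu> = ?T"
    using M by (auto simp: dagger_Frobenius_monad_def C_def Let_def Cell_iff)
  have F: "F \<in> Mor K B C" and \<sigma>: "\<sigma> \<in> Arr2 B C" "src B C \<sigma> = comp1 K B C C ?T F" "tgt B C \<sigma> = F"
    and eqs: "vcomp K B C \<sigma> (rwhisk K B C C ?\<eta> F) = id2 K B C F"
    "vcomp K B C \<sigma> (rwhisk K B C C ?\<mu> F) = vcomp K B C \<sigma> (lwhisk K B C C ?T \<sigma>)"
    "vcomp K B C (dag2 K B C \<sigma>) \<sigma>
      = vcomp K B C (rwhisk K B C C ?\<mu> F) (lwhisk K B C C ?T (dag2 K B C \<sigma>))"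
    using p dfm_morphism_trivial_iff[OF B M] by (auto simp: C_def Cell_iff)
  note [simp] = A B C \<eta> \<mu> F \<sigma> H
  show ?thesis
    using eqs[THEN arg_cong[where f = "\<lambda>\<phi>. rwhisk K A B C \<phi> H"]]
    unfolding dfm_morphism_trivial_iff[OF A M] C_def[symmetric]
    by (simp add: Cell_iff)
qed

section \<open>Composition in \<open>DFMonad K\<close> and the inclusion of \<open>K\<close>\<close>

lemma DFMonad_Ob [simp]: "Ob (DFMonad K) = {M. dagger_Frobenius_monad K M}"
  by (simp add: DFMonad_def)

lemma DFMonad_simps:
  "Mor (DFMonad K) M N = {p. dfm_morphism K M N p}"
  "Arr (Hom (DFMonad K) M N) = {(p, \<phi>, q). dfm_morphism K M N p \<and> dfm_morphism K M N q
    \<and> dfm_transformation K M N p q \<phi>}"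
  "id2 (DFMonad K) M N p = (p, id2 K (mbase M) (mbase N) (fst p), p)"
  "Unit (DFMonad K) M = (Unit K (mbase M), id2 K (mbase M) (mbase M) (mendo M))"
  "comp1 (DFMonad K) M N P q p = dfm_comp1 K (mbase M) (mbase N) (mbase P) q p"
  "hcomp (DFMonad K) M N P (q, \<psi>, q') (p, \<phi>, p') =
    (dfm_comp1 K (mbase M) (mbase N) (mbase P) q p,
     hcomp K (mbase M) (mbase N) (mbase P) \<psi> \<phi>,
     dfm_comp1 K (mbase M) (mbase N) (mbase P) q' p')"
  by (simp_all add: DFMonad_def dfm_hom_def Let_def)

lemma DFMonad_hcomp_assoc:
  assumes "dagger_Frobenius_monad K M" "dagger_Frobenius_monad K N"
    "dagger_Frobenius_monad K P" "dagger_Frobenius_monad K Q"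
    "\<Phi> \<in> Arr (Hom (DFMonad K) M N)" "\<Psi> \<in> Arr (Hom (DFMonad K) N P)"
    "X \<in> Arr (Hom (DFMonad K) P Q)"
  shows "hcomp (DFMonad K) M N Q (hcomp (DFMonad K) N P Q X \<Psi>) \<Phi>
    = hcomp (DFMonad K) M P Q X (hcomp (DFMonad K) M N P \<Psi> \<Phi>)"
proof -
  have "mbase M \<in> Ob K" "mbase N \<in> Ob K" "mbase P \<in> Ob K" "mbase Q \<in> Ob K"
    using assms by (auto simp: dagger_Frobenius_monad_def Let_def)
  moreover have "fst (snd \<Phi>) \<in> Arr2 (mbase M) (mbase N)"
    "fst (snd \<Psi>) \<in> Arr2 (mbase N) (mbase P)" "fst (snd X) \<in> Arr2 (mbase P) (mbase Q)"
    using assms by (auto simp: DFMonad_simps dfm_transformation_def Let_def Cell_iff)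
  ultimately show ?thesis
    using assms by (cases \<Phi>; cases \<Psi>; cases X) (simp add: DFMonad_simps dfm_comp1_assoc)
qed

lemma dfm_inclusion_simps [simp]:
  "TObj (dfm_inclusion K) = trivial_monad K"
  "TMor (dfm_inclusion K) A B F = (F, id2 K A B F)"
  "TCell (dfm_inclusion K) A B \<psi>
    = ((src A B \<psi>, id2 K A B (src A B \<psi>)), \<psi>, (tgt A B \<psi>, id2 K A B (tgt A B \<psi>)))"
  by (simp_all add: dfm_inclusion_def Let_def)

text \<open>Links the adjunction to algebras: composing the counit with an included 1-cell
  \<open>H\<close> amounts to restricting the counit algebra along \<open>H\<close>.\<close>

lemma dfm_comp1_inclusion:
  assumes "A \<in> Ob K" "B \<in> Ob K" "dagger_Frobenius_monad K M"
    "dfm_morphism K (trivial_monad K B) M (F, \<sigma>)" "H \<in> Mor K A B"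
  shows "dfm_comp1 K A B (mbase M) (F, \<sigma>) (H, id2 K A B H)
    = (comp1 K A B (mbase M) F H, rwhisk K A B (mbase M) \<sigma> H)"
  using assms dfm_morphism_trivial_iff[OF assms(2,3)]
  by (auto simp: dfm_comp1_def Cell_iff dagger_Frobenius_monad_def Let_def)

section \<open>The free algebra of a dagger Frobenius monad\<close>

text \<open>With \<open>P = \<mu>T \<circ> T\<mu>\<^sup>\<dagger> = T\<mu> \<circ> \<mu>\<^sup>\<dagger>T\<close>, the first form of \<open>P\<close> gives \<open>T\<eta>\<^sup>\<dagger> \<circ> P = \<mu>\<close>; substituting this
  in \<open>\<mu>\<^sup>\<dagger> \<circ> \<mu>\<close>, moving \<open>\<mu>\<^sup>\<dagger>\<close> to the front and using coassociativity recovers \<open>P\<close> in its second form.\<close>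

lemma Frobenius_mult_comult:
  assumes M: "dagger_Frobenius_monad K M"
  defines "C \<equiv> mbase M" and "T \<equiv> mendo M" and "\<mu> \<equiv> mmult M"
  shows "vcomp K C C (dag2 K C C \<mu>) \<mu>
    = vcomp K C C (rwhisk K C C C \<mu> T) (lwhisk K C C C T (dag2 K C C \<mu>))"
proof -
  let ?\<epsilon> = "dag2 K C C (munit M)" and ?\<delta> = "dag2 K C C \<mu>"
  note defs = C_def T_def \<mu>_def
  have C: "C \<in> Ob K" "T \<in> Mor K C C"
    and \<eta>: "munit M \<in> Arr2 C C" "src C C (munit M) = Unit K C" "tgt C C (munit M) = T"
    and \<mu>: "\<mu> \<in> Arr2 C C" "src C C \<mu> = comp1 K C C C T T" "tgt C C \<mu> = T"
    and assoc: "vcomp K C C \<mu> (lwhisk K C C C T \<mu>) = vcomp K C C \<mu> (rwhisk K C C C \<mu> T)"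
    and unit: "vcomp K C C \<mu> (lwhisk K C C C T (munit M)) = id2 K C C T"
    and frob: "vcomp K C C (rwhisk K C C C \<mu> T) (lwhisk K C C C T ?\<delta>)
      = vcomp K C C (lwhisk K C C C T \<mu>) (rwhisk K C C C ?\<delta> T)"
    using M by (auto simp: dagger_Frobenius_monad_def defs Let_def Cell_iff)
  note [simp] = C \<eta> \<mu>
  have coassoc: "vcomp K C C (lwhisk K C C C T ?\<delta>) ?\<delta> = vcomp K C C (rwhisk K C C C ?\<delta> T) ?\<delta>"
    using arg_cong[OF assoc, of "dag2 K C C"] by simp
  have counit: "vcomp K C C (lwhisk K C C C T ?\<epsilon>) ?\<delta> = id2 K C C T"
    using arg_cong[OF unit, of "dag2 K C C"] by simp
  have slide_counit_mult: "vcomp K C C (lwhisk K C C C T ?\<epsilon>) (rwhisk K C C C \<mu> T)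
      = vcomp K C C \<mu> (lwhisk K C C C T (lwhisk K C C C T ?\<epsilon>))"
    using whisk_exchange[of C C C ?\<epsilon> \<mu>] by simp
  have slide_counit_comult: "vcomp K C C ?\<delta> (lwhisk K C C C T ?\<epsilon>)
      = vcomp K C C (lwhisk K C C C T (lwhisk K C C C T ?\<epsilon>)) (rwhisk K C C C ?\<delta> T)"
    using whisk_exchange[of C C C ?\<epsilon> ?\<delta>] by simp
  have slide_mult_comult: "vcomp K C C (rwhisk K C C C ?\<delta> T) (lwhisk K C C C T \<mu>)
      = vcomp K C C (lwhisk K C C C T (lwhisk K C C C T \<mu>)) (rwhisk K C C C ?\<delta> (comp1 K C C C T T))"
    using whisk_exchange[of C C C \<mu> ?\<delta>] by simp
  have "vcomp K C C (lwhisk K C C C T ?\<epsilon>)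
      (vcomp K C C (rwhisk K C C C \<mu> T) (lwhisk K C C C T ?\<delta>))
    = vcomp K C C (vcomp K C C (lwhisk K C C C T ?\<epsilon>) (rwhisk K C C C \<mu> T)) (lwhisk K C C C T ?\<delta>)"
    by simp
  also have "\<dots> = vcomp K C C \<mu> (lwhisk K C C C T (vcomp K C C (lwhisk K C C C T ?\<epsilon>) ?\<delta>))"
    by (subst slide_counit_mult) simp
  also have "\<dots> = \<mu>"
    by (simp add: counit)
  finally have \<mu>_eq: "vcomp K C C (lwhisk K C C C T ?\<epsilon>)
      (vcomp K C C (lwhisk K C C C T \<mu>) (rwhisk K C C C ?\<delta> T)) = \<mu>"
    by (simp only: frob)
  have "vcomp K C C ?\<delta> \<mu> = vcomp K C C ?\<delta> (vcomp K C C (lwhisk K C C C T ?\<epsilon>)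
      (vcomp K C C (lwhisk K C C C T \<mu>) (rwhisk K C C C ?\<delta> T)))"
    by (rule arg_cong[OF \<mu>_eq[symmetric]])
  also have "\<dots> = vcomp K C C (vcomp K C C ?\<delta> (lwhisk K C C C T ?\<epsilon>))
      (vcomp K C C (lwhisk K C C C T \<mu>) (rwhisk K C C C ?\<delta> T))"
    by simp
  also have "\<dots> = vcomp K C C (lwhisk K C C C T (lwhisk K C C C T ?\<epsilon>))
      (vcomp K C C (vcomp K C C (rwhisk K C C C ?\<delta> T) (lwhisk K C C C T \<mu>)) (rwhisk K C C C ?\<delta> T))"
    by (subst slide_counit_comult) simp
  also have "\<dots> = vcomp K C C (lwhisk K C C C T (vcomp K C C (lwhisk K C C C T ?\<epsilon>) (lwhisk K C C C T \<mu>)))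
      (rwhisk K C C C (vcomp K C C (rwhisk K C C C ?\<delta> T) ?\<delta>) T)"
    by (subst slide_mult_comult) simp
  also have "\<dots> = vcomp K C C (lwhisk K C C C T (vcomp K C C (lwhisk K C C C T ?\<epsilon>) (lwhisk K C C C T \<mu>)))
      (rwhisk K C C C (vcomp K C C (lwhisk K C C C T ?\<delta>) ?\<delta>) T)"
    by (simp only: coassoc)
  also have "\<dots> = vcomp K C C (lwhisk K C C C T (vcomp K C C (lwhisk K C C C T ?\<epsilon>)
      (vcomp K C C (lwhisk K C C C T \<mu>) (rwhisk K C C C ?\<delta> T)))) (rwhisk K C C C ?\<delta> T)"
    by simp
  also have "\<dots> = vcomp K C C (rwhisk K C C C \<mu> T) (lwhisk K C C C T ?\<delta>)"
    by (simp only: \<mu>_eq frob)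
  finally show ?thesis .
qed

text \<open>For the action \<mu> the Frobenius law of an algebra is exactly
  \<open>Frobenius_mult_comult\<close>; the other two laws are monad laws.\<close>

lemma free_algebra:
  assumes M: "dagger_Frobenius_monad K M"
  shows "dfm_morphism K (trivial_monad K (mbase M)) M (mendo M, mmult M)"
proof -
  have "mbase M \<in> Ob K"
    using M by (simp add: dagger_Frobenius_monad_def Let_def)
  then show ?thesis
    using M Frobenius_mult_comult[OF M] dfm_morphism_trivial_iff[OF _ M]
    by (auto simp: dagger_Frobenius_monad_def Let_def)
qed

section \<open>The hom bijection of the dagger 2-adjunction\<close>

context
  fixes R :: "(('o, 'm, 'c) monad_data, 'm \<times> 'c, ('m, 'c) dfm_cell, 'o, 'm, 'c) two_func"
    and u :: "'o \<Rightarrow> 'm" and e :: "('o, 'm, 'c) monad_data \<Rightarrow> 'm \<times> 'c"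
  assumes adj: "dagger_2adjunction K (DFMonad K) (dfm_inclusion K) R u e"
begin

abbreviation (input) "L \<equiv> dfm_inclusion K"

text \<open>\<open>adjunct\<close> and \<open>coadjunct\<close> are the two transpositions, given on
  2-cells; 1-cells are later reached through their identity 2-cells.\<close>

abbreviation (input) "adjunct A M \<psi> \<equiv>
  lwhisk (DFMonad K) (trivial_monad K A) (trivial_monad K (TObj R M)) M (e M) (TCell L A (TObj R M) \<psi>)"

abbreviation (input) "coadjunct A M \<Phi> \<equiv>
  rwhisk K A (TObj R (trivial_monad K A)) (TObj R M) (TCell R (trivial_monad K A) M \<Phi>) (u A)"

lemma L: "dagger_2functor K (DFMonad K) L" and R: "dagger_2functor (DFMonad K) K R"
  and u: "two_natural K K id_2functor (comp_2functor R L) u"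
  and e: "two_natural (DFMonad K) (DFMonad K) (comp_2functor L R) id_2functor e"
  using adj by (auto simp: dagger_2adjunction_def)

lemma trivial_monad_Ob [simp]: "A \<in> Ob K \<Longrightarrow> dagger_Frobenius_monad K (trivial_monad K A)"
  using L by (simp add: dagger_2functor_def)

lemma R_Ob [simp]: "dagger_Frobenius_monad K M \<Longrightarrow> TObj R M \<in> Ob K"
  using R by (simp add: dagger_2functor_def)

lemma unit_Mor [simp]: "A \<in> Ob K \<Longrightarrow> u A \<in> Mor K A (TObj R (trivial_monad K A))"
  using u by (simp add: two_natural_def id_2functor_def comp_2functor_def)

lemma counit_Mor [simp]:
  "dagger_Frobenius_monad K M \<Longrightarrow> e M \<in> Mor (DFMonad K) (trivial_monad K (TObj R M)) M"
  using e by (simp add: two_natural_def id_2functor_def comp_2functor_def)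

lemma id_Arr_DFMonad [simp]:
  assumes "dagger_Frobenius_monad K M" "dagger_Frobenius_monad K N" "p \<in> Mor (DFMonad K) M N"
  shows "id2 (DFMonad K) M N p \<in> Arr (Hom (DFMonad K) M N)"
proof -
  obtain F \<sigma> where [simp]: "p = (F, \<sigma>)" by (cases p)
  have "dfm_transformation K M N p p (id2 K (mbase M) (mbase N) F)"
    using assms unfolding dfm_morphism_def dfm_transformation_def dagger_Frobenius_monad_def
    by (auto simp: DFMonad_simps dfm_morphism_def Let_def Cell_iff)
  then show ?thesis
    using assms by (simp add: DFMonad_simps)
qed

lemma L_Arr [simp]:
  assumes "A \<in> Ob K" "B \<in> Ob K" "\<psi> \<in> Arr2 A B"
  shows "TCell L A B \<psi> \<in> Arr (Hom (DFMonad K) (trivial_monad K A) (trivial_monad K B))"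
proof -
  have "\<psi> \<in> Cell K A B (src A B \<psi>) (tgt A B \<psi>)" "src A B \<psi> \<in> Mor K A B" "tgt A B \<psi> \<in> Mor K A B"
    using assms by (auto simp: Cell_iff)
  moreover have "dagger_functor (Hom K A B)
      (Hom (DFMonad K) (trivial_monad K A) (trivial_monad K B)) (THom L A B)"
    using L assms by (simp add: dagger_2functor_def)
  ultimately show ?thesis
    unfolding dagger_functor_def arrs_def by blast
qed

lemma R_Arr [simp]:
  assumes "dagger_Frobenius_monad K M" "dagger_Frobenius_monad K N" "\<Phi> \<in> Arr (Hom (DFMonad K) M N)"
  shows "TCell R M N \<Phi> \<in> Arr2 (TObj R M) (TObj R N)"
proof -
  obtain p \<phi> q where [simp]: "\<Phi> = (p, \<phi>, q)" by (cases \<Phi>)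
  have "\<Phi> \<in> Cell (DFMonad K) M N p q" "p \<in> Mor (DFMonad K) M N" "q \<in> Mor (DFMonad K) M N"
    using assms by (auto simp: DFMonad_simps arrs_def) (simp_all add: DFMonad_def dfm_hom_def Let_def)
  moreover have "dagger_functor (Hom (DFMonad K) M N) (Hom K (TObj R M) (TObj R N)) (THom R M N)"
    using R assms by (simp add: dagger_2functor_def)
  ultimately show ?thesis
    unfolding dagger_functor_def arrs_def by blast
qed

text \<open>Functoriality of \<open>R\<close> splits the transpose into \<open>R e\<close>,
  \<open>R L \<psi>\<close> and \<open>u\<close>; naturality of \<open>u\<close> moves \<psi> to the
  right end, and the triangle identity at \<open>R M\<close> cancels the rest.\<close>

lemma coadjunct_adjunct:
  assumes A: "A \<in> Ob K" and M: "dagger_Frobenius_monad K M" and \<psi>: "\<psi> \<in> Arr2 A (TObj R M)"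
  shows "coadjunct A M (adjunct A M \<psi>) = \<psi>"
proof -
  let ?a = "trivial_monad K A" and ?c = "trivial_monad K (TObj R M)"
  let ?Re = "TMor R ?c M (e M)"
  have Re: "?Re \<in> Mor K (TObj R ?c) (TObj R M)"
    using R M by (simp add: dagger_2functor_def dagger_functor_def)
  \<comment> \<open>Removing the unfolding rules of the inclusion keeps \<open>TCell L\<close>
    folded, so that \<open>L_Arr\<close> and \<open>R_Arr\<close> match.\<close>
  have RL: "TCell R ?a ?c (TCell L A (TObj R M) \<psi>) \<in> Arr2 (TObj R ?a) (TObj R ?c)"
    using A M \<psi> by (simp del: dfm_inclusion_simps)
  have "TCell R ?a M (adjunct A M \<psi>) = hcomp K (TObj R ?a) (TObj R ?c) (TObj R M)
      (TCell R ?c M (id2 (DFMonad K) ?c M (e M))) (TCell R ?a ?c (TCell L A (TObj R M) \<psi>))"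
    using R A M L_Arr[OF A R_Ob[OF M] \<psi>] id_Arr_DFMonad[OF _ M counit_Mor[OF M]]
    unfolding dagger_2functor_def by (simp del: dfm_inclusion_simps)
  also have "TCell R ?c M (id2 (DFMonad K) ?c M (e M)) = id2 K (TObj R ?c) (TObj R M) ?Re"
    using R M unfolding dagger_2functor_def dagger_functor_def by simp
  finally have "coadjunct A M (adjunct A M \<psi>) = lwhisk K A (TObj R ?c) (TObj R M) ?Re
      (rwhisk K A (TObj R ?a) (TObj R ?c) (TCell R ?a ?c (TCell L A (TObj R M) \<psi>)) (u A))"
    using A M Re RL by (simp del: dfm_inclusion_simps)
  also have "\<dots> = lwhisk K A (TObj R ?c) (TObj R M) ?Re
      (lwhisk K A (TObj R M) (TObj R ?c) (u (TObj R M)) \<psi>)"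
    using u A M \<psi> by (simp add: two_natural_def id_2functor_def comp_2functor_def)
  also have "\<dots> = lwhisk K A (TObj R M) (TObj R M)
      (comp1 K (TObj R M) (TObj R ?c) (TObj R M) ?Re (u (TObj R M))) \<psi>"
    using A M \<psi> Re by simp
  also have "\<dots> = \<psi>"
    using adj A M \<psi> by (simp add: dagger_2adjunction_def)
  finally show ?thesis .
qed

text \<open>The dual computation: functoriality of \<open>L\<close>, naturality of \<open>e\<close>
  at \<Phi>, and the triangle identity at \<open>A\<close>. Rebracketing takes place in
  \<open>DFMonad K\<close>, hence the explicit uses of \<open>DFMonad_hcomp_assoc\<close>.\<close>

lemma adjunct_coadjunct:
  assumes A: "A \<in> Ob K" and M: "dagger_Frobenius_monad K M"
    and \<Phi>: "\<Phi> \<in> Arr (Hom (DFMonad K) (trivial_monad K A) M)"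
  shows "adjunct A M (coadjunct A M \<Phi>) = \<Phi>"
proof -
  let ?K' = "DFMonad K"
  let ?a = "trivial_monad K A" and ?c = "trivial_monad K (TObj R M)"
  let ?Ra = "TObj R ?a" and ?b = "trivial_monad K (TObj R ?a)"
  let ?LR = "TCell L ?Ra (TObj R M) (TCell R ?a M \<Phi>)" and ?Lu = "TMor L A ?Ra (u A)"
  have a: "dagger_Frobenius_monad K ?a" "dagger_Frobenius_monad K ?b" "dagger_Frobenius_monad K ?c"
    using A M by simp_all
  have Ob: "?Ra \<in> Ob K" "TObj R M \<in> Ob K"
    using A M by simp_all
  have Lu: "?Lu \<in> Mor ?K' ?a ?b"
    using L A unfolding dagger_2functor_def dagger_functor_def by (simp del: dfm_inclusion_simps(2,3))
  have LR: "?LR \<in> Arr (Hom ?K' ?b ?c)"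
    using L_Arr[OF Ob R_Arr[OF a(1) M \<Phi>]] .
  have "TCell L A (TObj R M) (coadjunct A M \<Phi>)
      = hcomp ?K' ?a ?b ?c ?LR (TCell L A ?Ra (id2 K A ?Ra (u A)))"
    using L A Ob R_Arr[OF a(1) M \<Phi>] unfolding dagger_2functor_def
    by (simp del: dfm_inclusion_simps(2,3))
  also have "TCell L A ?Ra (id2 K A ?Ra (u A)) = id2 ?K' ?a ?b ?Lu"
    using L A unfolding dagger_2functor_def dagger_functor_def by (simp del: dfm_inclusion_simps(2,3))
  finally have "adjunct A M (coadjunct A M \<Phi>)
      = hcomp ?K' ?a ?b M (lwhisk ?K' ?b ?c M (e M) ?LR) (id2 ?K' ?a ?b ?Lu)"
    using DFMonad_hcomp_assoc[OF a M id_Arr_DFMonad[OF a(1,2) Lu] LR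
        id_Arr_DFMonad[OF a(3) M counit_Mor[OF M]]]
    by simp
  also have "lwhisk ?K' ?b ?c M (e M) ?LR = rwhisk ?K' ?b ?a M \<Phi> (e ?a)"
    using e a M \<Phi> unfolding two_natural_def id_2functor_def comp_2functor_def
    by (simp del: dfm_inclusion_simps(2,3))
  also have "hcomp ?K' ?a ?b M (rwhisk ?K' ?b ?a M \<Phi> (e ?a)) (id2 ?K' ?a ?b ?Lu)
      = hcomp ?K' ?a ?a M \<Phi> (hcomp ?K' ?a ?b ?a (id2 ?K' ?b ?a (e ?a)) (id2 ?K' ?a ?b ?Lu))"
    using DFMonad_hcomp_assoc[OF a(1,2,1) M id_Arr_DFMonad[OF a(1,2) Lu]
        id_Arr_DFMonad[OF a(2,1) counit_Mor[OF a(1)]] \<Phi>] .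
  also have "hcomp ?K' ?a ?b ?a (id2 ?K' ?b ?a (e ?a)) (id2 ?K' ?a ?b ?Lu)
      = id2 ?K' ?a ?a (comp1 ?K' ?a ?b ?a (e ?a) ?Lu)"
  proof -
    have "fst (e ?a) \<in> Mor K ?Ra A"
      using counit_Mor[OF a(1)] by (simp add: DFMonad_simps dfm_morphism_def Let_def)
    then show ?thesis
      using A by (simp add: DFMonad_simps dfm_comp1_def split: prod.splits)
  qed
  also have "comp1 ?K' ?a ?b ?a (e ?a) ?Lu = Unit ?K' ?a"
    using adj A by (simp add: dagger_2adjunction_def)
  \<comment> \<open>The right unit law of \<open>DFMonad K\<close>, checked on the three components
    of \<Phi>.\<close>
  also have "hcomp ?K' ?a ?a M \<Phi> (id2 ?K' ?a ?a (Unit ?K' ?a)) = \<Phi>"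
    using \<Phi> A M
    by (cases \<Phi>) (auto simp: DFMonad_simps dfm_comp1_Unit[OF a(1) M, simplified]
        dfm_transformation_def Cell_iff Let_def dagger_Frobenius_monad_def)
  finally show ?thesis .
qed

end

section \<open>The universal FEM-algebra\<close>

text \<open>Take \<open>D = FEM M\<close> and the counit at \<open>M\<close> as algebra.
  Transposition is bijective on 2-cells that carry their boundaries along; this yields existence of
  1-cells, and fullness and faithfulness on 2-cells.\<close>

lemma FEM_universal:
  assumes "admits_FEM_algebras K" and M: "dagger_Frobenius_monad K M"
  obtains D E \<sigma> where
    "D \<in> Ob K" "dfm_morphism K (trivial_monad K D) M (E, \<sigma>)"
    "\<And>A F \<rho>. A \<in> Ob K \<Longrightarrow> dfm_morphism K (trivial_monad K A) M (F, \<rho>) \<Longrightarrow>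
      \<exists>H \<in> Mor K A D. comp1 K A D (mbase M) E H = F \<and> rwhisk K A D (mbase M) \<sigma> H = \<rho>"
    "\<And>A H H' \<phi>. A \<in> Ob K \<Longrightarrow> H \<in> Mor K A D \<Longrightarrow> H' \<in> Mor K A D \<Longrightarrow>
      dfm_transformation K (trivial_monad K A) M
        (comp1 K A D (mbase M) E H, rwhisk K A D (mbase M) \<sigma> H)
        (comp1 K A D (mbase M) E H', rwhisk K A D (mbase M) \<sigma> H') \<phi> \<Longrightarrow>
      \<exists>\<psi> \<in> Cell K A D H H'. lwhisk K A D (mbase M) E \<psi> = \<phi>"
    "\<And>A H H' \<psi> \<psi>'. A \<in> Ob K \<Longrightarrow> \<psi> \<in> Cell K A D H H' \<Longrightarrow> \<psi>' \<in> Cell K A D H H' \<Longrightarrow>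
      lwhisk K A D (mbase M) E \<psi> = lwhisk K A D (mbase M) E \<psi>' \<Longrightarrow> \<psi> = \<psi>'"
proof -
  obtain R u e where adj: "dagger_2adjunction K (DFMonad K) (dfm_inclusion K) R u e"
    using assms by (auto simp: admits_FEM_algebras_def)
  let ?C = "mbase M"
  define D where "D = TObj R M"
  obtain E \<sigma> where e: "e M = (E, \<sigma>)" by (cases "e M")
  have D: "D \<in> Ob K"
    using R_Ob[OF adj M] by (simp add: D_def)
  have E: "dfm_morphism K (trivial_monad K D) M (E, \<sigma>)"
    using counit_Mor[OF adj M] by (simp add: DFMonad_simps D_def e)
  have C: "?C \<in> Ob K" "E \<in> Mor K D ?C"
    using M E by (simp_all add: dagger_Frobenius_monad_def dfm_morphism_def Let_def)
  let ?p = "\<lambda>A H. (comp1 K A D ?C E H, rwhisk K A D ?C \<sigma> H)"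
  \<comment> \<open>\<open>?tr\<close> is transposition across the adjunction, and \<open>?t\<close>
    is its explicit value: \<open>E\<psi>\<close> between the restrictions of the universal algebra
    along the boundaries of \<psi>.\<close>
  let ?t = "\<lambda>A \<psi>. (?p A (src A D \<psi>), lwhisk K A D ?C E \<psi>, ?p A (tgt A D \<psi>))"
  let ?tr = "\<lambda>A \<psi>. lwhisk (DFMonad K) (trivial_monad K A) (trivial_monad K D) M (e M)
    (TCell (dfm_inclusion K) A D \<psi>)"
  have tr: "?tr A \<psi> = ?t A \<psi>" if "A \<in> Ob K" "\<psi> \<in> Arr2 A D" for A \<psi>
    using that D by (simp add: DFMonad_simps e dfm_comp1_inclusion[OF _ D M E])
  have inj: "\<psi> = \<psi>'" if "A \<in> Ob K" "\<psi> \<in> Arr2 A D" "\<psi>' \<in> Arr2 A D" "?t A \<psi> = ?t A \<psi>'" for A \<psi> \<psi>'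
  proof -
    have "?tr A \<psi> = ?tr A \<psi>'"
      by (simp only: tr[OF that(1,2)] tr[OF that(1,3)] that(4))
    then show ?thesis
      using coadjunct_adjunct[OF adj that(1) M, folded D_def, OF that(2)]
        coadjunct_adjunct[OF adj that(1) M, folded D_def, OF that(3)]
      by simp
  qed
  have inj1: "H = H'" if "A \<in> Ob K" "H \<in> Mor K A D" "H' \<in> Mor K A D" "?p A H = ?p A H'" for A H H'
  proof -
    \<comment> \<open>Injectivity on 1-cells follows from injectivity on their identity
      2-cells.\<close>
    have "id2 K A D H = id2 K A D H'"
      by (rule inj[OF that(1)]) (use that C D in auto)
    then show ?thesis
      using id2_simps(2)[OF that(1) D] that(2,3) by metis
  qed
  have surj: "\<exists>\<psi> \<in> Arr2 A D. ?t A \<psi> = \<Phi>"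
    if A: "A \<in> Ob K" and \<Phi>: "\<Phi> \<in> Arr (Hom (DFMonad K) (trivial_monad K A) M)" for A \<Phi>
  proof -
    let ?a = "trivial_monad K A"
    \<comment> \<open>The preimage is the transpose of \<Phi> in the other direction.\<close>
    let ?\<psi> = "rwhisk K A (TObj R ?a) D (TCell R ?a M \<Phi>) (u A)"
    have "?\<psi> \<in> Arr2 A D"
      using A D R_Arr[OF adj trivial_monad_Ob[OF adj A] M \<Phi>] R_Ob[OF adj trivial_monad_Ob[OF adj A]]
        unit_Mor[OF adj A]
      by (simp add: D_def)
    moreover have "?tr A ?\<psi> = \<Phi>"
      using adjunct_coadjunct[OF adj A M \<Phi>] unfolding D_def .
    ultimately show ?thesis
      using tr[OF A] by metis
  qed
  show thesis
  proof (rule that[OF D E])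
    fix A F \<rho> assume A: "A \<in> Ob K" and p: "dfm_morphism K (trivial_monad K A) M (F, \<rho>)"
    \<comment> \<open>The required 1-cell is the source of the preimage of the identity 2-cell on
      the given algebra.\<close>
    then have "id2 (DFMonad K) (trivial_monad K A) M (F, \<rho>) \<in> Arr (Hom (DFMonad K) (trivial_monad K A) M)"
      by (intro id_Arr_DFMonad[OF adj trivial_monad_Ob[OF adj] M]) (simp_all add: DFMonad_simps)
    from surj[OF A this] obtain \<psi> where "\<psi> \<in> Arr2 A D" "?p A (src A D \<psi>) = (F, \<rho>)"
      by (auto simp: DFMonad_simps)
    then show "\<exists>H \<in> Mor K A D. comp1 K A D ?C E H = F \<and> rwhisk K A D ?C \<sigma> H = \<rho>"
      using A D by (intro bexI[of _ "src A D \<psi>"]) auto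
  next
    fix A H H' \<phi>
    assume A: "A \<in> Ob K" and H: "H \<in> Mor K A D" "H' \<in> Mor K A D"
      and \<phi>: "dfm_transformation K (trivial_monad K A) M (?p A H) (?p A H') \<phi>"
    have "(?p A H, \<phi>, ?p A H') \<in> Arr (Hom (DFMonad K) (trivial_monad K A) M)"
      using \<phi> dfm_morphism_rwhisk[OF A D M E H(1)] dfm_morphism_rwhisk[OF A D M E H(2)]
      by (simp add: DFMonad_simps)
    from surj[OF A this] obtain \<psi> where \<psi>: "\<psi> \<in> Arr2 A D" "?t A \<psi> = (?p A H, \<phi>, ?p A H')"
      by blast
    \<comment> \<open>The preimage has the right boundary only after restriction of the universal
      algebra; \<open>inj1\<close> recovers \<open>H\<close> and \<open>H'\<close>
      themselves.\<close>
    then have "src A D \<psi> = H" "tgt A D \<psi> = H'" "lwhisk K A D ?C E \<psi> = \<phi>"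
      using inj1[OF A] A D H by auto
    then show "\<exists>\<psi> \<in> Cell K A D H H'. lwhisk K A D ?C E \<psi> = \<phi>"
      using \<psi>(1) by (auto simp: Cell_iff)
  next
    fix A H H' \<psi> \<psi>'
    assume "A \<in> Ob K" "\<psi> \<in> Cell K A D H H'" "\<psi>' \<in> Cell K A D H H'"
      "lwhisk K A D ?C E \<psi> = lwhisk K A D ?C E \<psi>'"
    then show "\<psi> = \<psi>'"
      by (intro inj) (auto simp: Cell_iff)
  qed
qed

end

section \<open>The adjunction and its induced monad\<close>

theorem theorem7p5:
  fixes K :: "('o, 'm, 'c) two_cat" and T :: "('o, 'm, 'c) monad_data"
  assumes "dagger_2category K"
    and "admits_FEM_algebras K"
    and "dagger_Frobenius_monad K T"
  shows "\<exists>D J E \<eta> \<epsilon>. adjunction_in K (mbase T) D J E \<eta> \<epsilon> \<and>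
           induced_monad K (mbase T) D J E \<eta> \<epsilon> = T"
proof -
  interpret dagger_2cat K by unfold_locales fact
  note M = assms(3)
  let ?C = "mbase T" and ?T = "mendo T" and ?\<eta> = "munit T" and ?\<mu> = "mmult T"
  obtain D E \<sigma> where D: "D \<in> Ob K" and alg: "dfm_morphism K (trivial_monad K D) T (E, \<sigma>)"
    and ex1: "\<And>A F \<rho>. A \<in> Ob K \<Longrightarrow> dfm_morphism K (trivial_monad K A) T (F, \<rho>) \<Longrightarrow>
      \<exists>H \<in> Mor K A D. comp1 K A D ?C E H = F \<and> rwhisk K A D ?C \<sigma> H = \<rho>"
    and ex2: "\<And>A H H' \<phi>. A \<in> Ob K \<Longrightarrow> H \<in> Mor K A D \<Longrightarrow> H' \<in> Mor K A D \<Longrightarrow>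
      dfm_transformation K (trivial_monad K A) T
        (comp1 K A D ?C E H, rwhisk K A D ?C \<sigma> H)
        (comp1 K A D ?C E H', rwhisk K A D ?C \<sigma> H') \<phi> \<Longrightarrow>
      \<exists>\<psi> \<in> Cell K A D H H'. lwhisk K A D ?C E \<psi> = \<phi>"
    and faithful: "\<And>A H H' \<psi> \<psi>'. A \<in> Ob K \<Longrightarrow> \<psi> \<in> Cell K A D H H' \<Longrightarrow> \<psi>' \<in> Cell K A D H H' \<Longrightarrow>
      lwhisk K A D ?C E \<psi> = lwhisk K A D ?C E \<psi>' \<Longrightarrow> \<psi> = \<psi>'"
    using FEM_universal[OF assms(2) M] by blast
  have C: "?C \<in> Ob K" "?T \<in> Mor K ?C ?C"
    and \<eta>: "?\<eta> \<in> Arr2 ?C ?C" "src ?C ?C ?\<eta> = Unit K ?C" "tgt ?C ?C ?\<eta> = ?T"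
    and unit: "vcomp K ?C ?C ?\<mu> (lwhisk K ?C ?C ?C ?T ?\<eta>) = id2 K ?C ?C ?T"
    and \<mu>: "?\<mu> \<in> Arr2 ?C ?C" "src ?C ?C ?\<mu> = comp1 K ?C ?C ?C ?T ?T" "tgt ?C ?C ?\<mu> = ?T"
    using M by (auto simp: dagger_Frobenius_monad_def Let_def Cell_iff)
  have E: "E \<in> Mor K D ?C"
    and \<sigma>: "\<sigma> \<in> Arr2 D ?C" "src D ?C \<sigma> = comp1 K D ?C ?C ?T E" "tgt D ?C \<sigma> = E"
    and alg_unit: "vcomp K D ?C \<sigma> (rwhisk K D ?C ?C ?\<eta> E) = id2 K D ?C E"
    and alg_mult: "vcomp K D ?C \<sigma> (rwhisk K D ?C ?C ?\<mu> E) = vcomp K D ?C \<sigma> (lwhisk K D ?C ?C ?T \<sigma>)"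
    and alg_frob: "vcomp K D ?C (dag2 K D ?C \<sigma>) \<sigma>
      = vcomp K D ?C (rwhisk K D ?C ?C ?\<mu> E) (lwhisk K D ?C ?C ?T (dag2 K D ?C \<sigma>))"
    using alg dfm_morphism_trivial_iff[OF D M] by (auto simp: Cell_iff)
  obtain J where J: "J \<in> Mor K ?C D" and EJ: "comp1 K ?C D ?C E J = ?T"
    and \<sigma>J: "rwhisk K ?C D ?C \<sigma> J = ?\<mu>"
    using ex1[OF C(1) free_algebra[OF M]] by blast
  note [simp] = C D \<eta> \<mu> E \<sigma> J
  let ?JE = "comp1 K D ?C D J E"
  \<comment> \<open>The next two equations identify the restriction of the universal algebra along
    \<open>JE\<close> with \<open>(TE, \<mu>E)\<close>.\<close>
  have EJE: "comp1 K D D ?C E ?JE = comp1 K D ?C ?C ?T E"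
    using comp1_assoc[of D ?C D ?C E J E] EJ by simp
  have \<sigma>JE: "rwhisk K D D ?C \<sigma> ?JE = rwhisk K D ?C ?C ?\<mu> E"
    using hcomp_assoc[of D ?C D ?C "id2 K D ?C E" "id2 K ?C D J" \<sigma>] \<sigma>J by simp
  \<comment> \<open>For \<sigma> as a transformation, the homomorphism condition is the
    associativity law of the algebra and the condition on the dagger is its Frobenius law.\<close>
  have "dfm_transformation K (trivial_monad K D) T
      (comp1 K D D ?C E ?JE, rwhisk K D D ?C \<sigma> ?JE)
      (comp1 K D D ?C E (Unit K D), rwhisk K D D ?C \<sigma> (Unit K D)) \<sigma>"
    unfolding EJE \<sigma>JE dfm_transformation_trivial_iff[OF D M]
    by (simp add: Cell_iff alg_mult alg_frob)
  then obtain \<epsilon> where \<epsilon>_Cell: "\<epsilon> \<in> Cell K D D ?JE (Unit K D)" and E\<epsilon>: "lwhisk K D D ?C E \<epsilon> = \<sigma>"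
    using ex2[OF D, of ?JE "Unit K D" \<sigma>] by auto
  have \<epsilon>: "\<epsilon> \<in> Arr2 D D" "src D D \<epsilon> = ?JE" "tgt D D \<epsilon> = Unit K D"
    using \<epsilon>_Cell by (auto simp: Cell_iff)
  note [simp] = \<epsilon>
  have E\<epsilon>J: "lwhisk K ?C D ?C E (rwhisk K ?C D D \<epsilon> J) = ?\<mu>"
    using hcomp_assoc[of ?C D D ?C "id2 K ?C D J" \<epsilon> "id2 K D ?C E"] E\<epsilon> \<sigma>J by simp
  have EJ\<eta>: "lwhisk K ?C D ?C E (lwhisk K ?C ?C D J ?\<eta>) = lwhisk K ?C ?C ?C ?T ?\<eta>"
    using lwhisk_comp1[of ?C ?C D ?C ?\<eta> J E] EJ by simp
  \<comment> \<open>Makes the two factors of the triangle composable: \<open>\<epsilon>J\<close>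
    starts at \<open>(JE)J\<close>, while \<open>J\<eta>\<close> ends at \<open>JT\<close>.\<close>
  have JEJ: "comp1 K ?C D D ?JE J = comp1 K ?C ?C D J ?T"
    using comp1_assoc[of ?C D ?C D J E J] EJ by simp
  have "vcomp K ?C D (rwhisk K ?C D D \<epsilon> J) (lwhisk K ?C ?C D J ?\<eta>) = id2 K ?C D J"
  proof (rule faithful[OF C(1)])
    show "vcomp K ?C D (rwhisk K ?C D D \<epsilon> J) (lwhisk K ?C ?C D J ?\<eta>) \<in> Cell K ?C D J J"
      using JEJ by (simp add: Cell_iff EJ)
    show "id2 K ?C D J \<in> Cell K ?C D J J"
      by (simp add: Cell_iff)
    \<comment> \<open>Whiskered with \<open>E\<close>, the triangle reads
      \<open>\<mu> \<circ> T\<eta> = id\<close>.\<close>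
    show "lwhisk K ?C D ?C E (vcomp K ?C D (rwhisk K ?C D D \<epsilon> J) (lwhisk K ?C ?C D J ?\<eta>))
        = lwhisk K ?C D ?C E (id2 K ?C D J)"
      using JEJ by (simp add: EJ E\<epsilon>J EJ\<eta> unit)
  qed
  then have "adjunction_in K ?C D J E ?\<eta> \<epsilon>"
    using \<epsilon>_Cell alg_unit by (simp add: adjunction_in_def Cell_iff EJ E\<epsilon>)
  moreover have "induced_monad K ?C D J E ?\<eta> \<epsilon> = T"
    by (simp add: induced_monad_def EJ E\<epsilon>J)
  ultimately show ?thesis
    by blast
qed

end
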